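(* Let $p$ be a target density and $f$ a real-valued function, and consider the multiple importance sampling (MIS) estimator with balance heuristic built from $M$ different proposal distributions $q_1,\dots,q_M$, with $n_m$ samples $x^{1,m},\dots,x^{n_m,m}$ drawn from $q_m$ for each $m\in\{1,\dots,M\}$: $$\hat{\mathbb{E}}^{MIS}_p[f(x)]=\sum_{m=1}^{M}\sum_{i=1}^{n_m}\frac{p(x^{i,m})}{\sum_{j=1}^{M} n_j\, q_j(x^{i,m})}\,f(x^{i,m}).$$ Given a batch of $L$ i.i.d. samples from a distribution $q_{m'}$, where $q_{m'}$ could be one of the existing distributions $q_1,\dots,q_M$ or a new, previously unseen distribution, the estimator $\hat{\mathbb{E}}^{MIS}_p[f(x)]$ can be efficiently updated (so as to incorporate the batch) with computational complexity $O(M\cdot n_{avg}+M\cdot L)$ and memory complexity $O(M\cdot n_{avg})$, where $n_{avg}=\frac{1}{M}\sum_{m=1}^{M} n_m$ is the average sample count across the $M$ distributions of the given estimator.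
   Context: Samples arrive incrementally in batches, and quantities computed for the previous estimator (such as the samples and the denominators $\sum_j n_j q_j(x^{i,m})$) may be stored between batches. Updating the estimator means obtaining the balance-heuristic MIS estimator for the enlarged collection of samples: the sample count of $q_{m'}$ is increased by $L$ (it becomes $L$ if $q_{m'}$ is new, in which case $q_{m'}$ is added to the collection of distributions), and the sums over $m$ and $j$ range over all distributions present, with the updated counts. Complexity is counted with unit cost for each evaluation of $p$, of $f$, or of a density $q_j$ at a point, for each arithmetic operation, and for each stored sample or number. All samples lie where the denominators are positive. *)

theory Defs
  imports "HOL-Probability.Probability" "HOL-Library.Landau_Symbols"
begin

section \<open>The balance-heuristic estimator\<close>

text \<open>
  The \<open>M\<close> proposals are \<open>q 0, \<dots>, q (M - 1)\<close>, the sample count of \<open>q m\<close> is \<open>n m\<close>, and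
  \<open>x m i\<close> with \<open>i < n m\<close> is the \<open>i\<close>-th sample from \<open>q m\<close>; all indices start at \<open>0\<close>.
\<close>

definition denominator :: "(nat \<Rightarrow> 'a \<Rightarrow> real) \<Rightarrow> nat \<Rightarrow> (nat \<Rightarrow> nat) \<Rightarrow> 'a \<Rightarrow> real" where
  "denominator q M n z = (\<Sum>j<M. real (n j) * q j z)"

definition mis_estimator ::
  "('a \<Rightarrow> real) \<Rightarrow> ('a \<Rightarrow> real) \<Rightarrow> (nat \<Rightarrow> 'a \<Rightarrow> real) \<Rightarrow>
    nat \<Rightarrow> (nat \<Rightarrow> nat) \<Rightarrow> (nat \<Rightarrow> nat \<Rightarrow> 'a) \<Rightarrow> real" where
  "mis_estimator p f q M n x =
    (\<Sum>m<M. \<Sum>i<n m. p (x m i) / denominator q M n (x m i) * f (x m i))"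

definition n_avg :: "nat \<Rightarrow> (nat \<Rightarrow> nat) \<Rightarrow> real" where
  "n_avg M n = (1 / real M) * (\<Sum>m<M. real (n m))"

definition positive_denominators ::
  "(nat \<Rightarrow> 'a \<Rightarrow> real) \<Rightarrow> nat \<Rightarrow> (nat \<Rightarrow> nat) \<Rightarrow> (nat \<Rightarrow> nat \<Rightarrow> 'a) \<Rightarrow> bool" where
  "positive_denominators q M n x \<longleftrightarrow> (\<forall>m<M. \<forall>i<n m. 0 < denominator q M n (x m i))"


section \<open>Adding a batch\<close>

text \<open>
  A batch of \<open>L\<close> samples comes from \<open>q k\<close> with \<open>k \<le> M\<close>: for \<open>k < M\<close> this is one of the existing
  proposals, and \<open>k = M\<close> stands for a new one, which is then added to the collection.
\<close>

definition new_M :: "nat \<Rightarrow> nat \<Rightarrow> nat" where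
  "new_M M k = (if k < M then M else Suc M)"

definition old_count :: "nat \<Rightarrow> (nat \<Rightarrow> nat) \<Rightarrow> nat \<Rightarrow> nat" where
  "old_count M n m = (if m < M then n m else 0)"

definition new_n :: "nat \<Rightarrow> (nat \<Rightarrow> nat) \<Rightarrow> nat \<Rightarrow> nat \<Rightarrow> nat \<Rightarrow> nat" where
  "new_n M n L k m = old_count M n m + (if m = k then L else 0)"

definition new_x ::
  "nat \<Rightarrow> (nat \<Rightarrow> nat) \<Rightarrow> nat \<Rightarrow> (nat \<Rightarrow> nat \<Rightarrow> 'a) \<Rightarrow> (nat \<Rightarrow> 'a) \<Rightarrow> nat \<Rightarrow> nat \<Rightarrow> 'a" where
  "new_x M n k x y m i =
    (if m = k \<and> old_count M n k \<le> i then y (i - old_count M n k) else x m i)"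


section \<open>Probabilistic setting\<close>

definition prob_density :: "'a measure \<Rightarrow> ('a \<Rightarrow> real) \<Rightarrow> bool" where
  "prob_density \<nu> g \<longleftrightarrow>
    g \<in> borel_measurable \<nu> \<and> (\<forall>z\<in>space \<nu>. 0 \<le> g z) \<and> (\<integral>\<^sup>+ z. ennreal (g z) \<partial>\<nu>) = 1"

text \<open>
  Densities are taken with respect to a common reference measure \<open>\<nu>\<close>. The random points \<open>X m i\<close>
  are the samples of the given estimator, and \<open>Y 0, \<dots>, Y (L - 1)\<close> is the batch.
\<close>

definition mis_setting ::
  "'w measure \<Rightarrow> 'a measure \<Rightarrow> ('a \<Rightarrow> real) \<Rightarrow> (nat \<Rightarrow> 'a \<Rightarrow> real) \<Rightarrow>
    nat \<Rightarrow> (nat \<Rightarrow> nat) \<Rightarrow> nat \<Rightarrow> nat \<Rightarrow>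
    (nat \<Rightarrow> nat \<Rightarrow> 'w \<Rightarrow> 'a) \<Rightarrow> (nat \<Rightarrow> 'w \<Rightarrow> 'a) \<Rightarrow> bool" where
  "mis_setting \<Omega> \<nu> p q M n L k X Y \<longleftrightarrow>
    prob_space \<Omega> \<and> prob_density \<nu> p \<and>
    (\<forall>j<new_M M k. prob_density \<nu> (q j)) \<and>
    inj_on (\<lambda>j. density \<nu> (\<lambda>z. ennreal (q j z))) {..<new_M M k} \<and>
    (\<forall>m<M. \<forall>i<n m. distributed \<Omega> \<nu> (X m i) (\<lambda>z. ennreal (q m z))) \<and>
    (\<forall>l<L. distributed \<Omega> \<nu> (Y l) (\<lambda>z. ennreal (q k z))) \<and>
    prob_space.indep_vars \<Omega> (\<lambda>_. \<nu>) Y {..<L}"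


section \<open>Cost model\<close>

text \<open>
  Programs are straight-line: they may depend on the sizes \<open>M\<close>, \<open>n\<close>, \<open>L\<close>, \<open>k\<close>, but they reach
  \<open>p\<close>, \<open>f\<close>, the \<open>q j\<close> and the samples only through the instructions below, each of which costs
  one unit of time. A memory cell holds one sample point or one number, and each occupied cell
  costs one unit of memory. The only literals are 0 and 1, so that sample counts must be stored
  or computed like any other number.
\<close>

datatype 'a val = Point 'a | Number real

datatype cell = Sample nat nat | Denom nat nat | Count nat | Estimate | Work nat

datatype arith = Plus | Minus | Times | Divide

datatype instr =
    Receive cell
  | Eval_p cell cell
  | Eval_f cell cell
  | Eval_q nat cell cell
  | Arith arith cell cell cell
  | Zero cell
  | One cell
  | Discard cell

text \<open>
  The first cell named by an instruction is the one written. The second component of a machine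
  state is the part of the batch not yet received: the batch arrives one sample at a time, and
  a sample occupies memory from its \<open>Receive\<close> on, for as long as the program keeps it.
\<close>

type_synonym 'a mem = "cell \<Rightarrow> 'a val option"
type_synonym 'a state = "'a mem \<times> 'a list"

definition eval_at :: "('a \<Rightarrow> real) \<Rightarrow> cell \<Rightarrow> cell \<Rightarrow> 'a state \<Rightarrow> 'a state option" where
  "eval_at g c a s =
    (case fst s a of
      Some (Point z) \<Rightarrow> Some ((fst s)(c \<mapsto> Number (g z)), snd s)
    | _ \<Rightarrow> None)"

fun arith_val :: "arith \<Rightarrow> real \<Rightarrow> real \<Rightarrow> real option" where
  "arith_val Plus u v = Some (u + v)"
| "arith_val Minus u v = Some (u - v)"
| "arith_val Times u v = Some (u * v)"
| "arith_val Divide u v = (if v = 0 then None else Some (u / v))"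

fun step ::
  "('a \<Rightarrow> real) \<Rightarrow> ('a \<Rightarrow> real) \<Rightarrow> (nat \<Rightarrow> 'a \<Rightarrow> real) \<Rightarrow> instr \<Rightarrow> 'a state \<Rightarrow> 'a state option" where
  "step p f q (Receive c) s =
    (case snd s of [] \<Rightarrow> None | y # ys \<Rightarrow> Some ((fst s)(c \<mapsto> Point y), ys))"
| "step p f q (Eval_p c a) s = eval_at p c a s"
| "step p f q (Eval_f c a) s = eval_at f c a s"
| "step p f q (Eval_q j c a) s = eval_at (q j) c a s"
| "step p f q (Arith op c a b) s =
    (case (fst s a, fst s b) of
      (Some (Number u), Some (Number v)) \<Rightarrow>
        map_option (\<lambda>w. ((fst s)(c \<mapsto> Number w), snd s)) (arith_val op u v)
    | _ \<Rightarrow> None)"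
| "step p f q (Zero c) s = Some ((fst s)(c \<mapsto> Number 0), snd s)"
| "step p f q (One c) s = Some ((fst s)(c \<mapsto> Number 1), snd s)"
| "step p f q (Discard c) s = Some ((fst s)(c := None), snd s)"

text \<open>The number returned by \<open>run\<close> is the peak memory, initial and final states included.\<close>

fun run ::
  "('a \<Rightarrow> real) \<Rightarrow> ('a \<Rightarrow> real) \<Rightarrow> (nat \<Rightarrow> 'a \<Rightarrow> real) \<Rightarrow> instr list \<Rightarrow> 'a state \<Rightarrow>
    ('a state \<times> nat) option" where
  "run p f q [] s = Some (s, card (dom (fst s)))"
| "run p f q (i # is) s =
    (case step p f q i s of
      None \<Rightarrow> None
    | Some s' \<Rightarrow>
        map_option (\<lambda>(t, peak). (t, max (card (dom (fst s))) peak)) (run p f q is s'))"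

text \<open>
  The data kept between batches: the samples, their denominators, the nonzero sample counts, and
  the value of the estimator.
\<close>

definition stored ::
  "('a \<Rightarrow> real) \<Rightarrow> ('a \<Rightarrow> real) \<Rightarrow> (nat \<Rightarrow> 'a \<Rightarrow> real) \<Rightarrow>
    nat \<Rightarrow> (nat \<Rightarrow> nat) \<Rightarrow> (nat \<Rightarrow> nat \<Rightarrow> 'a) \<Rightarrow> 'a mem" where
  "stored p f q M n x c =
    (case c of
      Sample m i \<Rightarrow> if m < M \<and> i < n m then Some (Point (x m i)) else None
    | Denom m i \<Rightarrow>
        if m < M \<and> i < n m then Some (Number (denominator q M n (x m i))) else None
    | Count m \<Rightarrow> if m < M \<and> 0 < n m then Some (Number (real (n m))) else None
    | Estimate \<Rightarrow> Some (Number (mis_estimator p f q M n x))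
    | Work _ \<Rightarrow> None)"


section \<open>Sizes of an update\<close>

type_synonym sizes = "nat \<times> (nat \<Rightarrow> nat) \<times> nat \<times> nat"

text \<open>
  The given estimator has at least one sample: without any, the bounds
  \<open>O(M * n_avg M n)\<close> would leave no room even for the value of the estimator. Individual counts
  may be zero. Landau symbols over \<open>principal update_sizes\<close> express bounds with one
  constant for all sizes.
\<close>

definition update_sizes :: "sizes set" where
  "update_sizes = {(M, n, L, k). 1 \<le> M \<and> 0 < (\<Sum>m<M. n m) \<and> k \<le> M}"

text \<open>
  \<open>updates upd cells post\<close>: starting from the stored data of the given estimator, and whatever
  the densities, the integrand and the samples are, \<open>upd\<close> receives the whole batch and
  establishes \<open>post\<close>, never occupying more than \<open>cells\<close> memory cells. The argument \<open>post\<close> is applied to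
  \<open>p\<close>, \<open>f\<close>, \<open>q\<close>, the data of the enlarged collection of samples, and the final memory.
  The type argument fixes the type of the underlying probability space.
\<close>

definition updates ::
  "'w itself \<Rightarrow> (sizes \<Rightarrow> instr list) \<Rightarrow> (sizes \<Rightarrow> nat) \<Rightarrow>
    (('a \<Rightarrow> real) \<Rightarrow> ('a \<Rightarrow> real) \<Rightarrow> (nat \<Rightarrow> 'a \<Rightarrow> real) \<Rightarrow>
      nat \<Rightarrow> (nat \<Rightarrow> nat) \<Rightarrow> (nat \<Rightarrow> nat \<Rightarrow> 'a) \<Rightarrow> 'a mem \<Rightarrow> bool) \<Rightarrow> bool" where
  "updates TYPE('w) upd cells post \<longleftrightarrow>
    (\<forall>M n L k. (M, n, L, k) \<in> update_sizes \<longrightarrow>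
      (\<forall>(\<Omega> :: 'w measure) (\<nu> :: 'a measure) p f q X Y. mis_setting \<Omega> \<nu> p q M n L k X Y \<longrightarrow>
        (\<forall>\<omega>\<in>space \<Omega>.
          let x = (\<lambda>m i. X m i \<omega>); y = (\<lambda>l. Y l \<omega>);
              M' = new_M M k; n' = new_n M n L k; x' = new_x M n k x y
          in positive_denominators q M n x \<longrightarrow> positive_denominators q M' n' x' \<longrightarrow>
            (\<exists>h peak.
              run p f q (upd (M, n, L, k)) (stored p f q M n x, map y [0..<L])
                = Some ((h, []), peak) \<and>
              peak \<le> cells (M, n, L, k) \<and>
              post p f q M' n' x' h))))"

end

theory Submission
  imports Defs
begin

text \<open>
  Adding \<open>L\<close> samples of \<open>q k\<close> changes the denominator at every old sample \<open>z\<close> by \<open>L * q k z\<close>, so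
  with the stored denominators each old sample costs a constant number of operations; only the
  \<open>L\<close> new denominators are computed from scratch, with \<open>O(M)\<close> operations each. If just the
  value of the estimator is wanted, every batch sample can be discarded once its term has been
  added, so that no memory beyond that of the stored data is needed, up to a constant. Proposals
  with count zero are skipped, since neither their densities nor their counts contribute.
\<close>

section \<open>Running programs\<close>

text \<open>Drops the peak from \<open>run\<close>, so that the effect of a program and its memory
  use can be proved separately.\<close>

definition exec ::
  "('a \<Rightarrow> real) \<Rightarrow> ('a \<Rightarrow> real) \<Rightarrow> (nat \<Rightarrow> 'a \<Rightarrow> real) \<Rightarrow> instr list \<Rightarrow> 'a state \<Rightarrow> 'a state option"
  where "exec p f q is s = map_option fst (run p f q is s)"

lemma exec_Nil [simp]: "exec p f q [] s = Some s"
  by (simp add: exec_def)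

lemma exec_Cons [simp]:
  "exec p f q (i # is) s = Option.bind (step p f q i s) (exec p f q is)"
  by (auto simp: exec_def option.map_comp comp_def case_prod_unfold split: option.splits)

lemma exec_append:
  "exec p f q (is @ js) s = Option.bind (exec p f q is s) (exec p f q js)"
  by (induction "is" arbitrary: s) (auto split: Option.bind_splits)

lemma exec_appendI:
  assumes "exec p f q is s = Some s'" and "exec p f q js s' = Some t"
  shows "exec p f q (is @ js) s = Some t"
  using assms by (simp add: exec_append)

text \<open>Programs are straight-line, so a loop whose bound depends on the sizes only is unrolled;
  its running time is the sum of the lengths of its bodies.\<close>

definition for_upto :: "nat \<Rightarrow> (nat \<Rightarrow> instr list) \<Rightarrow> instr list" where
  "for_upto n body = concat (map body [0..<n])"

lemma set_for_upto: "set (for_upto n body) = (\<Union>i<n. set (body i))"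
  by (auto simp: for_upto_def)

lemma length_for_upto: "length (for_upto n body) = (\<Sum>i<n. length (body i))"
  by (induction n) (simp_all add: for_upto_def)

text \<open>A loop rule with a complete state \<open>S i\<close> before pass \<open>i\<close>
  instead of an invariant predicate, since execution is deterministic.\<close>

lemma exec_for_upto:
  assumes "\<And>i. i < n \<Longrightarrow> exec p f q (body i) (S i) = Some (S (Suc i))"
  shows "exec p f q (for_upto n body) (S 0) = Some (S n)"
  using assms by (induction n) (simp_all add: for_upto_def exec_append)

section \<open>Static bounds on the peak memory\<close>

fun target :: "instr \<Rightarrow> cell" where
  "target (Receive c) = c"
| "target (Eval_p c a) = c"
| "target (Eval_f c a) = c"
| "target (Eval_q j c a) = c"
| "target (Arith op c a b) = c"
| "target (Zero c) = c"
| "target (One c) = c"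
| "target (Discard c) = c"

lemma dom_step:
  assumes "step p f q i s = Some s'"
  shows "dom (fst s') \<subseteq> insert (target i) (dom (fst s))"
  using assms
  by (cases i) (auto simp: eval_at_def split: list.splits option.splits val.splits if_splits)

text \<open>A cell becomes occupied only by being a target, so every intermediate domain lies in
  \<open>D\<close>. \<open>Discard\<close> earns no credit here: a small bound relies on reusing the
  same cells.\<close>

lemma run_peak_le:
  assumes "run p f q is s = Some (t, peak)" "finite D" "dom (fst s) \<subseteq> D" "target ` set is \<subseteq> D"
  shows "peak \<le> card D"
  using assms
proof (induction "is" arbitrary: s t peak)
  case Nil
  then show ?case by (auto intro: card_mono)
next
  case (Cons i "is")
  from Cons.prems(1) obtain s' peak' where s': "step p f q i s = Some s'"
    and r: "run p f q is s' = Some (t, peak')" and peak: "peak = max (card (dom (fst s))) peak'"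
    by (auto split: option.splits)
  have "dom (fst s') \<subseteq> D"
    using dom_step[OF s'] Cons.prems(3,4) by auto
  then have "peak' \<le> card D"
    using Cons.IH[OF r] Cons.prems by auto
  then show ?case
    using peak Cons.prems by (simp add: card_mono)
qed

lemma run_of_exec:
  assumes "exec p f q is s = Some t" "finite D" "dom (fst s) \<subseteq> D" "target ` set is \<subseteq> D"
  shows "\<exists>peak. run p f q is s = Some (t, peak) \<and> peak \<le> card D"
proof -
  obtain peak where "run p f q is s = Some (t, peak)"
    using assms(1) by (auto simp: exec_def)
  with run_peak_le[OF this assms(2-4)] show ?thesis by blast
qed


section \<open>The update program\<close>

text \<open>Serves twice: with \<open>L\<close> in \<open>w\<close> it corrects a stored
  denominator, and with \<open>w = Count j\<close> it adds the \<open>j\<close>-th summand of a new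
  one.\<close>

definition add_scaled :: "nat \<Rightarrow> cell \<Rightarrow> cell \<Rightarrow> cell \<Rightarrow> instr list" where
  "add_scaled j a w d =
    [Eval_q j (Work 1) a, Arith Times (Work 1) w (Work 1), Arith Plus d d (Work 1),
     Discard (Work 1)]"

definition add_term :: "cell \<Rightarrow> cell \<Rightarrow> instr list" where
  "add_term a d =
    [Eval_p (Work 1) a, Arith Divide (Work 1) (Work 1) d, Eval_f (Work 2) a,
     Arith Times (Work 1) (Work 1) (Work 2), Arith Plus Estimate Estimate (Work 1),
     Discard (Work 1), Discard (Work 2)]"

text \<open>Since 0 and 1 are the only literals, \<open>L\<close> has to be counted out. The
  \<open>L + 3\<close> instructions are affordable because \<open>M \<ge> 1\<close>.\<close>

definition batch_size :: "nat \<Rightarrow> instr list" where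
  "batch_size L =
    [Zero (Work 0), One (Work 1)] @
    for_upto L (\<lambda>_. [Arith Plus (Work 0) (Work 0) (Work 1)]) @ [Discard (Work 1)]"

text \<open>A proposal with count zero has no \<open>Count\<close> cell, so the cell is created
  first; for \<open>L = 0\<close> nothing may be created, as zero counts are not stored.\<close>

definition update_count :: "nat \<Rightarrow> (nat \<Rightarrow> nat) \<Rightarrow> nat \<Rightarrow> nat \<Rightarrow> instr list" where
  "update_count M n L k =
    (if L = 0 then []
     else (if old_count M n k = 0 then [Zero (Count k)] else []) @
       [Arith Plus (Count k) (Count k) (Work 0)])"

definition old_samples :: "nat \<Rightarrow> (nat \<Rightarrow> nat) \<Rightarrow> nat \<Rightarrow> instr list" where
  "old_samples M n k =
    for_upto M (\<lambda>m. for_upto (n m) (\<lambda>i.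
      add_scaled k (Sample m i) (Work 0) (Denom m i) @ add_term (Sample m i) (Denom m i)))"

text \<open>Indices with \<open>n' j = 0\<close> are left out: the stored format has no cell
  \<open>Count j\<close> for them, and reading it would abort the run.\<close>

definition batch_sample :: "nat \<Rightarrow> (nat \<Rightarrow> nat) \<Rightarrow> cell \<Rightarrow> cell \<Rightarrow> instr list" where
  "batch_sample M' n' a d =
    [Receive a, Zero d] @
    for_upto M' (\<lambda>j. if n' j = 0 then [] else add_scaled j a (Count j) d) @ add_term a d"

text \<open>Shared by both programs, which differ only in where they put the batch.
  \<open>Estimate\<close> restarts from zero because each old term can change with its
  denominator.\<close>

definition prelude :: "nat \<Rightarrow> (nat \<Rightarrow> nat) \<Rightarrow> nat \<Rightarrow> nat \<Rightarrow> instr list" where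
  "prelude M n L k =
    batch_size L @ update_count M n L k @ [Zero Estimate] @ old_samples M n k @
    [Discard (Work 0)]"

definition update_estimate :: "nat \<Rightarrow> (nat \<Rightarrow> nat) \<Rightarrow> nat \<Rightarrow> nat \<Rightarrow> instr list" where
  "update_estimate M n L k =
    prelude M n L k @
    for_upto L (\<lambda>_. batch_sample (new_M M k) (new_n M n L k) (Work 3) (Work 4) @
      [Discard (Work 3), Discard (Work 4)])"

definition update_stored :: "nat \<Rightarrow> (nat \<Rightarrow> nat) \<Rightarrow> nat \<Rightarrow> nat \<Rightarrow> instr list" where
  "update_stored M n L k =
    prelude M n L k @
    for_upto L (\<lambda>l. batch_sample (new_M M k) (new_n M n L k)
      (Sample k (old_count M n k + l)) (Denom k (old_count M n k + l)))"

section \<open>Effect of the building blocks on the memory\<close>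

lemma exec_add_scaled:
  assumes "h a = Some (Point z)" "h w = Some (Number u)" "h d = Some (Number v)"
    "h (Work 1) = None"
  shows "exec p f q (add_scaled j a w d) (h, ys) = Some (h(d \<mapsto> Number (v + u * q j z)), ys)"
proof -
  \<comment> \<open>The scratch cell is empty at the start while \<open>w\<close> and
    \<open>d\<close> are occupied, so they differ from it; discarding it at the end restores the
    initial memory there.\<close>
  have "w \<noteq> Work 1" "d \<noteq> Work 1" using assms by auto
  with assms show ?thesis by (auto simp: add_scaled_def eval_at_def fun_eq_iff)
qed

lemma exec_add_term:
  assumes "h a = Some (Point z)" "h d = Some (Number v)" "v \<noteq> 0"
    "h Estimate = Some (Number e)" "h (Work 1) = None" "h (Work 2) = None"
  shows "exec p f q (add_term a d) (h, ys) =
    Some (h(Estimate \<mapsto> Number (e + p z / v * f z)), ys)"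
proof -
  have "a \<noteq> Work 1" "d \<noteq> Work 1" using assms by auto
  with assms show ?thesis by (auto simp: add_term_def eval_at_def fun_eq_iff)
qed

lemma exec_batch_size:
  assumes "h (Work 0) = None" "h (Work 1) = None"
  shows "exec p f q (batch_size L) (h, ys) = Some (h(Work 0 \<mapsto> Number (real L)), ys)"
proof -
  define S where "S l = (h(Work 0 \<mapsto> Number (real l), Work 1 \<mapsto> Number 1), ys)" for l :: nat
  have "exec p f q (for_upto L (\<lambda>_. [Arith Plus (Work 0) (Work 0) (Work 1)])) (S 0) = Some (S L)"
    by (rule exec_for_upto) (auto simp: S_def fun_eq_iff)
  moreover have "exec p f q [Zero (Work 0), One (Work 1)] (h, ys) = Some (S 0)"
    by (simp add: S_def)
  moreover have "exec p f q [Discard (Work 1)] (S L) = Some (h(Work 0 \<mapsto> Number (real L)), ys)"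
    using assms by (auto simp: S_def fun_eq_iff)
  ultimately show ?thesis
    unfolding batch_size_def by (blast intro: exec_appendI)
qed

lemma exec_batch_sample:
  assumes counts: "\<And>j. j < M' \<Longrightarrow> 0 < n' j \<Longrightarrow> h (Count j) = Some (Number (real (n' j)))"
    and est: "h Estimate = Some (Number e)"
    and free: "h a = None" "h d = None" "h (Work 1) = None" "h (Work 2) = None"
    and cells: "a \<noteq> d" "a \<noteq> Work 1" "a \<noteq> Work 2" "d \<noteq> Work 1" "d \<noteq> Work 2"
      "a \<notin> range Count" "d \<notin> range Count"
    and pos: "denominator q M' n' z \<noteq> 0"
  shows "exec p f q (batch_sample M' n' a d) (h, z # ys) =
    Some (h(a \<mapsto> Point z, d \<mapsto> Number (denominator q M' n' z),
      Estimate \<mapsto> Number (e + p z / denominator q M' n' z * f z)), ys)"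
proof -
  \<comment> \<open>Cutting the denominator off after \<open>j\<close> proposals gives the partial
    sum held in \<open>d\<close>; proposals with count zero leave it unchanged.\<close>
  define S where "S j = (h(a \<mapsto> Point z, d \<mapsto> Number (denominator q j n' z)), ys)" for j
  have "exec p f q [Receive a, Zero d] (h, z # ys) = Some (S 0)"
    by (simp add: S_def denominator_def)
  moreover have "exec p f q
      (for_upto M' (\<lambda>j. if n' j = 0 then [] else add_scaled j a (Count j) d)) (S 0) = Some (S M')"
  proof (rule exec_for_upto)
    fix j assume j: "j < M'"
    show "exec p f q (if n' j = 0 then [] else add_scaled j a (Count j) d) (S j) =
      Some (S (Suc j))"
    proof (cases "n' j = 0")
      case True
      then show ?thesis by (simp add: S_def denominator_def)
    next
      case False
      have "Count j \<noteq> a" "Count j \<noteq> d" using cells by auto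
      then have "exec p f q (add_scaled j a (Count j) d) (S j) =
          Some ((fst (S j))(d \<mapsto> Number (denominator q j n' z + real (n' j) * q j z)), ys)"
        unfolding S_def fst_conv
        by (intro exec_add_scaled) (use False j counts free cells in auto)
      then show ?thesis
        using False by (simp add: S_def denominator_def)
    qed
  qed
  moreover have "exec p f q (add_term a d) (S M') =
      Some ((fst (S M'))(Estimate \<mapsto> Number (e + p z / denominator q M' n' z * f z)), ys)"
    unfolding S_def fst_conv
    by (intro exec_add_term) (use est free cells pos in auto)
  ultimately show ?thesis
    unfolding batch_sample_def by (auto intro!: exec_appendI simp: S_def)
qed


section \<open>Correctness\<close>

text \<open>Row \<open>k\<close> is cut at \<open>old_count M n k\<close>: the old samples lie
  before it, the batch from there on. As \<open>old_count\<close> is zero in row \<open>M\<close>, a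
  new proposal is just an empty row that gets filled.\<close>

lemma sum_enlarged:
  fixes g :: "'a \<Rightarrow> real"
  assumes "k \<le> M"
  shows "(\<Sum>m<new_M M k. \<Sum>i<new_n M n L k m. g (new_x M n k x y m i)) =
    (\<Sum>m<M. \<Sum>i<n m. g (x m i)) + (\<Sum>l<L. g (y l))"
proof -
  have inner: "(\<Sum>i<new_n M n L k m. g (new_x M n k x y m i)) =
      (\<Sum>i<old_count M n m. g (x m i)) + (if m = k then \<Sum>l<L. g (y l) else 0)" for m
  proof (cases "m = k")
    case True
    have "(\<Sum>i<old_count M n k + L. g (new_x M n k x y k i)) =
        (\<Sum>i<old_count M n k. g (x k i)) + (\<Sum>l<L. g (y l))"
      by (induction L) (simp_all add: new_x_def)
    with True show ?thesis by (simp add: new_n_def)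
  qed (simp add: new_n_def new_x_def)
  have "(\<Sum>m<new_M M k. \<Sum>i<old_count M n m. g (x m i)) = (\<Sum>m<M. \<Sum>i<n m. g (x m i))"
    by (simp add: new_M_def old_count_def)
  moreover have "k < new_M M k" using assms by (simp add: new_M_def)
  ultimately show ?thesis
    by (simp add: inner sum.distrib)
qed

text \<open>The denominator is linear in the counts, and only the count of \<open>q k\<close> grows,
  by \<open>L\<close>. Hence the correction at an old sample costs a constant number of
  operations.\<close>

lemma denominator_enlarged:
  assumes "k \<le> M"
  shows "denominator q (new_M M k) (new_n M n L k) z = denominator q M n z + real L * q k z"
proof -
  have "denominator q (new_M M k) (new_n M n L k) z =
      (\<Sum>j<new_M M k. real (old_count M n j) * q j z + (if j = k then real L * q j z else 0))"
    unfolding denominator_def by (rule sum.cong) (auto simp: new_n_def algebra_simps)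
  also have "\<dots> = (\<Sum>j<new_M M k. real (old_count M n j) * q j z) + real L * q k z"
    using assms by (simp add: sum.distrib new_M_def)
  also have "(\<Sum>j<new_M M k. real (old_count M n j) * q j z) = denominator q M n z"
    by (simp add: new_M_def old_count_def denominator_def)
  finally show ?thesis .
qed

text \<open>One update with the values of the samples at a fixed outcome, so that everything here is
  deterministic.\<close>

locale batch_update =
  fixes p f :: "'a \<Rightarrow> real" and q :: "nat \<Rightarrow> 'a \<Rightarrow> real"
    and M L k :: nat and n :: "nat \<Rightarrow> nat" and x :: "nat \<Rightarrow> nat \<Rightarrow> 'a" and y :: "nat \<Rightarrow> 'a"
  assumes k_le: "k \<le> M"
    and positive: "positive_denominators q (new_M M k) (new_n M n L k) (new_x M n k x y)"
begin

abbreviation "M' \<equiv> new_M M k"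
abbreviation "n' \<equiv> new_n M n L k"
abbreviation "x' \<equiv> new_x M n k x y"
abbreviation "D' \<equiv> denominator q M' n'"

definition summand :: "'a \<Rightarrow> real" where
  "summand z = p z / D' z * f z"

text \<open>Not the value of the given estimator in general: the old samples are weighted with the
  new denominators \<open>D'\<close>.\<close>

definition old_part :: real where
  "old_part = (\<Sum>m<M. \<Sum>i<n m. summand (x m i))"

lemma mis_estimator_enlarged:
  "mis_estimator p f q M' n' x' = old_part + (\<Sum>l<L. summand (y l))"
  using sum_enlarged[OF k_le, where n = n and L = L and g = summand and x = x and y = y]
  by (simp add: mis_estimator_def summand_def old_part_def)

text \<open>\<open>Divide\<close> fails on zero, so each term requires this; an old sample keeps its
  indices in the enlarged collection.\<close>

lemma D'_old_nonzero: "m < M \<Longrightarrow> i < n m \<Longrightarrow> D' (x m i) \<noteq> 0"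
proof -
  assume "m < M" "i < n m"
  then have "m < M'" "i < n' m" "x' m i = x m i"
    by (auto simp: new_M_def new_n_def new_x_def old_count_def)
  with positive show ?thesis
    unfolding positive_denominators_def by (metis less_irrefl)
qed

lemma D'_batch_nonzero: "l < L \<Longrightarrow> D' (y l) \<noteq> 0"
proof -
  assume "l < L"
  then have "k < M'" "old_count M n k + l < n' k" "x' k (old_count M n k + l) = y l"
    using k_le by (auto simp: new_M_def new_n_def new_x_def)
  with positive show ?thesis
    unfolding positive_denominators_def by (metis less_irrefl)
qed

section \<open>Memory after each stage of the prelude\<close>

definition mem_counted :: "'a mem" where
  "mem_counted c =
    (case c of
      Count m \<Rightarrow> if m < M' \<and> 0 < n' m then Some (Number (real (n' m))) else None
    | Work i \<Rightarrow> if i = 0 then Some (Number (real L)) else None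
    | _ \<Rightarrow> stored p f q M n x c)"

lemma exec_update_count:
  "exec p f q (update_count M n L k) ((stored p f q M n x)(Work 0 \<mapsto> Number (real L)), ys) =
    Some (mem_counted, ys)"
  using k_le
proof -
  let ?h = "(stored p f q M n x)(Work 0 \<mapsto> Number (real L))"
  let ?n = "old_count M n k"
  have counted: "mem_counted = (if L = 0 then ?h else ?h(Count k \<mapsto> Number (real (?n + L))))"
  proof
    fix c
    show "mem_counted c = (if L = 0 then ?h else ?h(Count k \<mapsto> Number (real (?n + L)))) c"
      using k_le
      by (cases c) (simp_all add: mem_counted_def stored_def new_M_def new_n_def old_count_def)
  qed
  have count: "stored p f q M n x (Count k) = (if ?n = 0 then None else Some (Number (real ?n)))"
    by (simp add: stored_def old_count_def)
  show ?thesis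
    unfolding counted update_count_def
    by (cases "L = 0"; cases "?n = 0") (simp_all add: count)
qed

text \<open>\<open>updated\<close> tells which old denominators are already corrected, so that one
  shape describes the double loop at every moment between two samples.\<close>

definition mem_old :: "(nat \<Rightarrow> nat \<Rightarrow> bool) \<Rightarrow> real \<Rightarrow> 'a mem" where
  "mem_old updated e c =
    (case c of
      Denom m i \<Rightarrow>
        if m < M \<and> i < n m \<and> updated m i then Some (Number (D' (x m i))) else mem_counted c
    | Estimate \<Rightarrow> Some (Number e)
    | _ \<Rightarrow> mem_counted c)"

lemma exec_old_samples:
  "exec p f q (old_samples M n k) (mem_counted(Estimate \<mapsto> Number 0), ys) =
    Some (mem_old (\<lambda>_ _. True) old_part, ys)"
proof -
  \<comment> \<open>Samples before \<open>(m, i)\<close> in lexicographic order are finished, and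
    the estimate is the sum of their terms.\<close>
  define S where "S m i = (mem_old (\<lambda>m' i'. m' < m \<or> m' = m \<and> i' < i)
    ((\<Sum>m'<m. \<Sum>i'<n m'. summand (x m' i')) + (\<Sum>i'<i. summand (x m i'))), ys)" for m i
  let ?body = "\<lambda>m i. add_scaled k (Sample m i) (Work 0) (Denom m i) @
    add_term (Sample m i) (Denom m i)"
  have body: "exec p f q (?body m i) (S m i) = Some (S m (Suc i))"
    if "m < M" "i < n m" for m i
  proof (rule exec_appendI)
    have "exec p f q (add_scaled k (Sample m i) (Work 0) (Denom m i)) (S m i) =
        Some ((fst (S m i))(Denom m i \<mapsto>
          Number (denominator q M n (x m i) + real L * q k (x m i))), ys)"
      unfolding S_def fst_conv
      by (intro exec_add_scaled) (use that in \<open>auto simp: mem_old_def mem_counted_def stored_def\<close>)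
    then show "exec p f q (add_scaled k (Sample m i) (Work 0) (Denom m i)) (S m i) =
        Some ((fst (S m i))(Denom m i \<mapsto> Number (D' (x m i))), ys)"
      by (simp add: denominator_enlarged[OF k_le])
    have "exec p f q (add_term (Sample m i) (Denom m i))
        ((fst (S m i))(Denom m i \<mapsto> Number (D' (x m i))), ys) =
      Some ((fst (S m i))(Denom m i \<mapsto> Number (D' (x m i)), Estimate \<mapsto> Number
        (((\<Sum>m'<m. \<Sum>i'<n m'. summand (x m' i')) + (\<Sum>i'<i. summand (x m i'))) +
          p (x m i) / D' (x m i) * f (x m i))), ys)"
      unfolding S_def fst_conv
      by (intro exec_add_term)
        (use that D'_old_nonzero in \<open>auto simp: mem_old_def mem_counted_def stored_def\<close>)
    also have "\<dots> = Some (S m (Suc i))"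
      using that by (auto simp: S_def mem_old_def summand_def fun_eq_iff split: cell.splits)
    finally show "exec p f q (add_term (Sample m i) (Denom m i))
        ((fst (S m i))(Denom m i \<mapsto> Number (D' (x m i))), ys) = Some (S m (Suc i))" .
  qed
  have "exec p f q (old_samples M n k) (S 0 0) = Some (S M 0)"
    unfolding old_samples_def
  proof (rule exec_for_upto[where S = "\<lambda>m. S m 0"])
    fix m assume "m < M"
    then have "exec p f q (for_upto (n m) (?body m)) (S m 0) = Some (S m (n m))"
      by (intro exec_for_upto body)
    \<comment> \<open>A finished row and a next row not yet begun are the same state, as
      \<open>mem_old\<close> looks only at indices \<open>i < n m\<close>; this links the inner loop
      to the outer one.\<close>
    also have "S m (n m) = S (Suc m) 0"
      by (auto simp: S_def mem_old_def less_Suc_eq fun_eq_iff split: cell.splits)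
    finally show "exec p f q (for_upto (n m) (?body m)) (S m 0) = Some (S (Suc m) 0)" .
  qed
  moreover have "S 0 0 = (mem_counted(Estimate \<mapsto> Number 0), ys)"
    by (auto simp: S_def mem_old_def fun_eq_iff split: cell.splits)
  moreover have "S M 0 = (mem_old (\<lambda>_ _. True) old_part, ys)"
    by (auto simp: S_def mem_old_def old_part_def fun_eq_iff split: cell.splits)
  ultimately show ?thesis by simp
qed

section \<open>Processing the batch\<close>

definition base :: "'a mem" where
  "base = (mem_old (\<lambda>_ _. True) old_part)(Work 0 := None)"

lemma exec_prelude: "exec p f q (prelude M n L k) (stored p f q M n x, ys) = Some (base, ys)"
  unfolding prelude_def
proof (intro exec_appendI)
  show "exec p f q (batch_size L) (stored p f q M n x, ys) =
      Some ((stored p f q M n x)(Work 0 \<mapsto> Number (real L)), ys)"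
    by (rule exec_batch_size) (simp_all add: stored_def)
qed (rule exec_update_count exec_old_samples | simp add: base_def)+

lemma base_simps:
  "base Estimate = Some (Number old_part)"
  "base (Count j) = (if j < M' \<and> 0 < n' j then Some (Number (real (n' j))) else None)"
  "base (Sample m i) = (if m < M \<and> i < n m then Some (Point (x m i)) else None)"
  "base (Denom m i) = (if m < M \<and> i < n m then Some (Number (D' (x m i))) else None)"
  "base (Work i) = None"
  by (simp_all add: base_def mem_old_def mem_counted_def stored_def)

text \<open>Both cells used for a batch sample are emptied again, so each pass starts and ends with
  \<open>base\<close> up to the value of \<open>Estimate\<close>.\<close>

lemma exec_update_estimate:
  "exec p f q (update_estimate M n L k) (stored p f q M n x, map y [0..<L]) =
    Some (base(Estimate \<mapsto> Number (mis_estimator p f q M' n' x')), [])"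
proof -
  define S where "S l = (base(Estimate \<mapsto> Number (old_part + (\<Sum>l'<l. summand (y l')))),
    map y [l..<L])" for l
  have "exec p f q (for_upto L (\<lambda>_. batch_sample M' n' (Work 3) (Work 4) @
      [Discard (Work 3), Discard (Work 4)])) (S 0) = Some (S L)"
  proof (rule exec_for_upto, rule exec_appendI)
    fix l assume l: "l < L"
    then have "map y [l..<L] = y l # map y [Suc l..<L]"
      by (simp add: upt_conv_Cons)
    then show "exec p f q (batch_sample M' n' (Work 3) (Work 4)) (S l) =
        Some ((fst (S l))(Work 3 \<mapsto> Point (y l), Work 4 \<mapsto> Number (D' (y l)),
          Estimate \<mapsto> Number (old_part + (\<Sum>l'<l. summand (y l')) +
            p (y l) / D' (y l) * f (y l))), map y [Suc l..<L])"
      unfolding S_def fst_conv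
      by (simp only:, intro exec_batch_sample) (use l D'_batch_nonzero in \<open>auto simp: base_simps\<close>)
    show "exec p f q [Discard (Work 3), Discard (Work 4)]
        ((fst (S l))(Work 3 \<mapsto> Point (y l), Work 4 \<mapsto> Number (D' (y l)),
          Estimate \<mapsto> Number (old_part + (\<Sum>l'<l. summand (y l')) +
            p (y l) / D' (y l) * f (y l))), map y [Suc l..<L]) = Some (S (Suc l))"
      by (auto simp: S_def base_simps summand_def fun_eq_iff)
  qed
  moreover have "S 0 = (base, map y [0..<L])"
    by (auto simp: S_def base_simps fun_eq_iff)
  moreover have "S L = (base(Estimate \<mapsto> Number (mis_estimator p f q M' n' x')), [])"
    by (simp add: S_def mis_estimator_enlarged)
  ultimately show ?thesis
    unfolding update_estimate_def by (intro exec_appendI[OF exec_prelude]) simp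
qed

text \<open>The result is in exactly the format that an update starts from, so the next batch can be
  handled in the same way.\<close>

lemma exec_update_stored:
  "exec p f q (update_stored M n L k) (stored p f q M n x, map y [0..<L]) =
    Some (stored p f q M' n' x', [])"
proof -
  define o' where "o' = old_count M n k"
  define new where "new l m i \<longleftrightarrow> m = k \<and> o' \<le> i \<and> i < o' + l" for l m i
  define h where "h l c =
    (case c of
      Sample m i \<Rightarrow> if new l m i then Some (Point (y (i - o'))) else base c
    | Denom m i \<Rightarrow> if new l m i then Some (Number (D' (y (i - o')))) else base c
    | Estimate \<Rightarrow> Some (Number (old_part + (\<Sum>l'<l. summand (y l'))))
    | _ \<Rightarrow> base c)" for l c
  \<comment> \<open>The cells for the next sample are empty: they lie behind the old samples of row
    \<open>k\<close>, and for \<open>k = M\<close> that row is not stored at all.\<close>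
  have free: "\<not> (k < M \<and> o' + l < n k)" for l
    by (simp add: o'_def old_count_def)
  have "exec p f q (for_upto L (\<lambda>l. batch_sample M' n' (Sample k (o' + l)) (Denom k (o' + l))))
      (h 0, map y [0..<L]) = Some (h L, map y [L..<L])"
  proof (rule exec_for_upto[where S = "\<lambda>l. (h l, map y [l..<L])"])
    fix l assume l: "l < L"
    then have "map y [l..<L] = y l # map y [Suc l..<L]"
      by (simp add: upt_conv_Cons)
    then have "exec p f q (batch_sample M' n' (Sample k (o' + l)) (Denom k (o' + l)))
        (h l, map y [l..<L]) =
        Some ((h l)(Sample k (o' + l) \<mapsto> Point (y l), Denom k (o' + l) \<mapsto> Number (D' (y l)),
          Estimate \<mapsto> Number (old_part + (\<Sum>l'<l. summand (y l')) +
            p (y l) / D' (y l) * f (y l))), map y [Suc l..<L])"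
      by (simp only:, intro exec_batch_sample)
        (use l D'_batch_nonzero free[of l] in \<open>auto simp: h_def new_def base_simps\<close>)
    also have "(h l)(Sample k (o' + l) \<mapsto> Point (y l), Denom k (o' + l) \<mapsto> Number (D' (y l)),
          Estimate \<mapsto> Number (old_part + (\<Sum>l'<l. summand (y l')) +
            p (y l) / D' (y l) * f (y l))) = h (Suc l)"
      by (auto simp: h_def new_def summand_def fun_eq_iff split: cell.splits)
    finally show "exec p f q (batch_sample M' n' (Sample k (o' + l)) (Denom k (o' + l)))
        (h l, map y [l..<L]) = Some (h (Suc l), map y [Suc l..<L])" .
  qed
  moreover have "h 0 = base"
    by (auto simp: h_def new_def base_simps fun_eq_iff split: cell.splits)
  moreover have "h L = stored p f q M' n' x'"
  proof
    fix c show "h L c = stored p f q M' n' x' c"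
    proof (cases c)
      case Estimate
      then show ?thesis by (simp add: h_def stored_def mis_estimator_enlarged)
    qed (use k_le in \<open>auto simp: h_def new_def o'_def base_simps stored_def new_M_def new_n_def
        new_x_def old_count_def\<close>)
  qed
  ultimately show ?thesis
    unfolding update_stored_def o'_def by (intro exec_appendI[OF exec_prelude]) simp
qed

end


section \<open>Complexity\<close>

text \<open>The domain of \<open>stored\<close>, which depends on the sizes only and can therefore
  be counted without knowing the samples.\<close>

definition footprint :: "nat \<Rightarrow> (nat \<Rightarrow> nat) \<Rightarrow> cell set" where
  "footprint M n =
    (\<lambda>(m, i). Sample m i) ` (SIGMA m:{..<M}. {..<n m}) \<union>
    (\<lambda>(m, i). Denom m i) ` (SIGMA m:{..<M}. {..<n m}) \<union>
    Count ` {m. m < M \<and> 0 < n m} \<union> {Estimate}"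

lemma finite_footprint [simp]: "finite (footprint M n)"
  by (simp add: footprint_def)

lemma footprint_iff:
  "Sample m i \<in> footprint M n \<longleftrightarrow> m < M \<and> i < n m"
  "Denom m i \<in> footprint M n \<longleftrightarrow> m < M \<and> i < n m"
  "Count m \<in> footprint M n \<longleftrightarrow> m < M \<and> 0 < n m"
  "Estimate \<in> footprint M n"
  "Work i \<notin> footprint M n"
  by (auto simp: footprint_def)

lemma dom_stored: "dom (stored p f q M n x) = footprint M n"
proof (rule set_eqI)
  fix c show "c \<in> dom (stored p f q M n x) \<longleftrightarrow> c \<in> footprint M n"
    by (cases c) (auto simp: stored_def footprint_iff split: if_splits)
qed

text \<open>Each sample has one sample cell and one denominator cell; stored counts are positive, so
  there are no more of them than samples. The last 1 is \<open>Estimate\<close>. Storing zero counts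
  too would bring in \<open>M\<close>, which the number of samples does not bound.\<close>

lemma card_footprint_le: "card (footprint M n) \<le> 3 * (\<Sum>m<M. n m) + 1"
proof -
  let ?S = "(\<lambda>(m, i). Sample m i) ` (SIGMA m:{..<M}. {..<n m})"
  let ?D = "(\<lambda>(m, i). Denom m i) ` (SIGMA m:{..<M}. {..<n m})"
  let ?C = "Count ` {m. m < M \<and> 0 < n m}"
  have s: "card (SIGMA m:{..<M}. {..<n m}) = (\<Sum>m<M. n m)"
    by simp
  have "card {m. m < M \<and> 0 < n m} = (\<Sum>m | m < M \<and> 0 < n m. 1)"
    by simp
  also have "\<dots> \<le> (\<Sum>m | m < M \<and> 0 < n m. n m)"
    by (rule sum_mono) auto
  also have "\<dots> \<le> (\<Sum>m<M. n m)"
    by (rule sum_mono2) auto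
  finally have "card ?C \<le> (\<Sum>m<M. n m)"
    using card_image_le[of "{m. m < M \<and> 0 < n m}" Count] by simp
  moreover have "card ?S \<le> (\<Sum>m<M. n m)" "card ?D \<le> (\<Sum>m<M. n m)"
    using s by (metis card_image_le finite_SigmaI finite_lessThan)+
  ultimately show ?thesis
    unfolding footprint_def
    using card_Un_le[of "?S \<union> ?D \<union> ?C" "{Estimate}"] card_Un_le[of "?S \<union> ?D" ?C]
      card_Un_le[of ?S ?D] by simp
qed

section \<open>Cells written by the programs\<close>

lemma targets_add_scaled: "target ` set (add_scaled j a w d) = {Work 1, d}"
  by (auto simp: add_scaled_def)

lemma targets_add_term: "target ` set (add_term a d) = {Work 1, Work 2, Estimate}"
  by (auto simp: add_term_def)

lemma targets_batch_sample:
  "target ` set (batch_sample M n a d) \<subseteq> {Work 1, Work 2, Estimate, a, d}"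
  unfolding batch_sample_def set_append set_for_upto image_Un image_UN targets_add_term
  by (intro Un_least UN_least) (simp_all add: targets_add_scaled)

text \<open>\<open>Count k\<close> is listed separately because it is outside the old footprint if
  \<open>q k\<close> has no samples yet.\<close>

lemma targets_prelude:
  "target ` set (prelude M n L k) \<subseteq>
    footprint M n \<union> Work ` {..<3} \<union> (if L = 0 then {} else {Count k})"
proof -
  have "target ` set (old_samples M n k) \<subseteq> footprint M n \<union> Work ` {..<3}"
    unfolding old_samples_def set_append set_for_upto image_Un image_UN targets_add_term
      targets_add_scaled
    by (intro Un_least UN_least) (simp_all add: footprint_iff)
  then show ?thesis
    by (auto simp: prelude_def batch_size_def update_count_def set_for_upto footprint_iff)
qed

text \<open>At most six cells on top of the footprint, whatever \<open>L\<close> is; this is where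
  reusing \<open>Work 3\<close> and \<open>Work 4\<close> pays off.\<close>

definition estimate_cells :: "nat \<Rightarrow> (nat \<Rightarrow> nat) \<Rightarrow> nat \<Rightarrow> cell set" where
  "estimate_cells M n k = footprint M n \<union> Work ` {..<5} \<union> {Count k}"

definition stored_cells :: "nat \<Rightarrow> (nat \<Rightarrow> nat) \<Rightarrow> nat \<Rightarrow> nat \<Rightarrow> cell set" where
  "stored_cells M n L k = footprint (new_M M k) (new_n M n L k) \<union> Work ` {..<3}"

lemma targets_update_estimate:
  "target ` set (update_estimate M n L k) \<subseteq> estimate_cells M n k"
proof -
  have "target ` set (batch_sample (new_M M k) (new_n M n L k) (Work 3) (Work 4))
      \<subseteq> estimate_cells M n k"
    by (rule order_trans[OF targets_batch_sample]) (auto simp: estimate_cells_def footprint_iff)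
  moreover have "target ` set (prelude M n L k) \<subseteq> estimate_cells M n k"
    by (rule order_trans[OF targets_prelude]) (auto simp: estimate_cells_def)
  ultimately show ?thesis
    by (auto simp: update_estimate_def set_for_upto) (auto simp: estimate_cells_def)
qed

lemma footprint_enlarged: "footprint M n \<subseteq> footprint (new_M M k) (new_n M n L k)"
  by (auto simp: footprint_def new_M_def new_n_def old_count_def)

lemma targets_update_stored:
  assumes "k \<le> M"
  shows "target ` set (update_stored M n L k) \<subseteq> stored_cells M n L k"
proof -
  have "target ` set (batch_sample (new_M M k) (new_n M n L k)
      (Sample k (old_count M n k + l)) (Denom k (old_count M n k + l))) \<subseteq> stored_cells M n L k"
    if "l < L" for l
    by (rule order_trans[OF targets_batch_sample])
      (use that assms in \<open>auto simp: stored_cells_def footprint_iff new_M_def new_n_def\<close>)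
  moreover have "target ` set (prelude M n L k) \<subseteq> stored_cells M n L k"
    by (rule order_trans[OF targets_prelude])
      (use assms footprint_enlarged[of M n k L] in
        \<open>auto simp: stored_cells_def footprint_iff new_M_def new_n_def\<close>)
  ultimately show ?thesis
    by (auto simp: update_stored_def set_for_upto)
qed

text \<open>Reduces a claim on all random outcomes to deterministic execution and to a set
  \<open>C\<close> of cells that contains the initial domain and all targets.\<close>

lemma updatesI:
  fixes post :: "('a \<Rightarrow> real) \<Rightarrow> ('a \<Rightarrow> real) \<Rightarrow> (nat \<Rightarrow> 'a \<Rightarrow> real) \<Rightarrow>
      nat \<Rightarrow> (nat \<Rightarrow> nat) \<Rightarrow> (nat \<Rightarrow> nat \<Rightarrow> 'a) \<Rightarrow> 'a mem \<Rightarrow> bool"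
  assumes exec: "\<And>p f q M L k n x y. batch_update q M L k n x y \<Longrightarrow>
      \<exists>h. exec p f q (upd (M, n, L, k)) (stored p f q M n x, map y [0..<L]) = Some (h, []) \<and>
        post p f q (new_M M k) (new_n M n L k) (new_x M n k x y) h"
    and finite: "\<And>s. finite (C s)"
    and initial: "\<And>M n L k. footprint M n \<subseteq> C (M, n, L, k)"
    and targets: "\<And>M n L k. k \<le> M \<Longrightarrow> target ` set (upd (M, n, L, k)) \<subseteq> C (M, n, L, k)"
  shows "updates TYPE('w) upd (\<lambda>s. card (C s)) post"
proof -
  have "\<exists>h peak. run p f q (upd (M, n, L, k)) (stored p f q M n x, map y [0..<L]) =
        Some ((h, []), peak) \<and> peak \<le> card (C (M, n, L, k)) \<and>
        post p f q (new_M M k) (new_n M n L k) (new_x M n k x y) h"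
    if "(M, n, L, k) \<in> update_sizes"
      "positive_denominators q (new_M M k) (new_n M n L k) (new_x M n k x y)"
    for p f q M n L k and x :: "nat \<Rightarrow> nat \<Rightarrow> 'a" and y
  proof -
    have k: "k \<le> M" using that by (simp add: update_sizes_def)
    with that have "batch_update q M L k n x y"
      by (simp add: batch_update_def)
    from exec[OF this] obtain h
      where h: "exec p f q (upd (M, n, L, k)) (stored p f q M n x, map y [0..<L]) = Some (h, [])"
        "post p f q (new_M M k) (new_n M n L k) (new_x M n k x y) h"
      by blast
    obtain peak
      where "run p f q (upd (M, n, L, k)) (stored p f q M n x, map y [0..<L]) = Some ((h, []), peak)"
        "peak \<le> card (C (M, n, L, k))"
      using run_of_exec[OF h(1) finite[of "(M, n, L, k)"]] initial[of M n L k]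
        targets[OF k, of n L]
      by (auto simp: dom_stored)
    with h show ?thesis by blast
  qed
  then show ?thesis
    unfolding updates_def Let_def by blast
qed

section \<open>Counting instructions and cells\<close>

lemma length_batch_sample: "length (batch_sample M n a d) \<le> 4 * M + 9"
proof -
  have "(\<Sum>j<M. length (if n j = 0 then [] else add_scaled j a (Count j) d)) \<le> (\<Sum>j<M. 4)"
    by (rule sum_mono) (simp add: add_scaled_def)
  then show ?thesis
    by (simp add: batch_sample_def length_for_upto add_term_def)
qed

text \<open>Each old sample takes 4 instructions for its denominator and 7 for its term. The batch
  size takes \<open>L + 3\<close>, the count at most 2, and resetting \<open>Estimate\<close> and
  freeing \<open>Work 0\<close> one each.\<close>

lemma length_prelude: "length (prelude M n L k) \<le> 11 * (\<Sum>m<M. n m) + L + 7"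
proof -
  have "length (add_scaled k a w d @ add_term a d) = 11" for a w d
    by (simp add: add_scaled_def add_term_def)
  then have "length (old_samples M n k) = (\<Sum>m<M. n m * 11)"
    by (simp only: old_samples_def length_for_upto sum_constant card_lessThan) simp
  also have "\<dots> = 11 * (\<Sum>m<M. n m)"
    by (simp flip: sum_distrib_right)
  finally show ?thesis
    by (simp add: prelude_def batch_size_def update_count_def length_for_upto)
qed

text \<open>The 11 allows for the 9 instructions of \<open>batch_sample\<close> outside its loop and
  for two discards.\<close>

lemma length_with_batch:
  assumes "(M, n, L, k) \<in> update_sizes" and "\<And>l. length (body l) \<le> 4 * new_M M k + 11"
  shows "length (prelude M n L k @ for_upto L body) \<le> 20 * ((\<Sum>m<M. n m) + M * L)"
proof -
  have M: "1 \<le> M" "1 \<le> (\<Sum>m<M. n m)" and new: "new_M M k \<le> M + 1"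
    using assms(1) by (auto simp: update_sizes_def new_M_def)
  \<comment> \<open>\<open>4 * (M + 1) + 11 = 4 * M + 15\<close>, and
    \<open>15 \<le> 15 * M\<close>.\<close>
  have "(\<Sum>l<L. length (body l)) \<le> (\<Sum>l<L. 19 * M)"
    by (rule sum_mono, rule order_trans[OF assms(2)]) (use M new in linarith)
  then have "length (for_upto L body) \<le> 19 * (M * L)"
    by (simp add: length_for_upto mult_ac)
  \<comment> \<open>The \<open>L + 7\<close> left over from the prelude is absorbed by
    \<open>M * L\<close> and by 7 times the number of samples, which is at least 1.\<close>
  moreover have "L \<le> M * L" using M by simp
  ultimately show ?thesis
    using length_prelude[of M n L k] M(2) unfolding length_append distrib_left by linarith
qed

lemma length_update_estimate:
  assumes "(M, n, L, k) \<in> update_sizes"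
  shows "length (update_estimate M n L k) \<le> 20 * ((\<Sum>m<M. n m) + M * L)"
  unfolding update_estimate_def
  by (rule length_with_batch[OF assms])
    (use length_batch_sample[of "new_M M k" "new_n M n L k" "Work 3" "Work 4"] in simp)

lemma length_update_stored:
  assumes "(M, n, L, k) \<in> update_sizes"
  shows "length (update_stored M n L k) \<le> 20 * ((\<Sum>m<M. n m) + M * L)"
  unfolding update_stored_def
  by (rule length_with_batch[OF assms]) (rule order_trans[OF length_batch_sample], simp)

text \<open>For \<open>S\<close> samples there are at most \<open>3 * S + 1 + 6\<close> cells, and
  \<open>7 \<le> 7 * S\<close> since \<open>S \<ge> 1\<close>.\<close>

lemma card_estimate_cells:
  assumes "(M, n, L, k) \<in> update_sizes"
  shows "card (estimate_cells M n k) \<le> 10 * (\<Sum>m<M. n m)"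
proof -
  have "card (estimate_cells M n k) \<le> card (footprint M n) + 5 + 1"
    unfolding estimate_cells_def
    by (intro order_trans[OF card_Un_le] add_mono order.refl)
      (auto intro: order_trans[OF card_image_le])
  with card_footprint_le[of M n] assms show ?thesis
    by (simp add: update_sizes_def)
qed

lemma card_stored_cells:
  assumes "(M, n, L, k) \<in> update_sizes"
  shows "card (stored_cells M n L k) \<le> 10 * (\<Sum>m<new_M M k. new_n M n L k m)"
proof -
  have "card (stored_cells M n L k) \<le> card (footprint (new_M M k) (new_n M n L k)) + 3"
    unfolding stored_cells_def
    by (intro order_trans[OF card_Un_le] add_mono order.refl)
      (auto intro: order_trans[OF card_image_le])
  \<comment> \<open>The enlarged collection inherits at least one sample, which absorbs the additive
    constant again.\<close>
  moreover have "(\<Sum>m<M. n m) \<le> (\<Sum>m<new_M M k. new_n M n L k m)"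
    by (rule order_trans[OF sum_mono sum_mono2]) (auto simp: new_M_def new_n_def old_count_def)
  ultimately show ?thesis
    using card_footprint_le[of "new_M M k" "new_n M n L k"] assms by (simp add: update_sizes_def)
qed

section \<open>Passing to Landau symbols\<close>

lemma n_avg_mult: "1 \<le> M \<Longrightarrow> real M * n_avg M n = real (\<Sum>m<M. n m)"
  by (simp add: n_avg_def)

text \<open>Over a principal filter, eventually means for all members, so an explicit bound
  suffices. Absolute values enter because Landau symbols compare norms.\<close>

lemma bigo_sizesI:
  assumes "\<And>M n L k. (M, n, L, k) \<in> update_sizes \<Longrightarrow> real (g (M, n, L, k)) \<le> c * b M n L k"
  shows "(\<lambda>s. real (g s)) \<in> O[principal update_sizes](\<lambda>(M, n, L, k). b M n L k)"
proof (rule bigoI[where c = "\<bar>c\<bar>"])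
  have "real (g (M, n, L, k)) \<le> \<bar>c\<bar> * \<bar>b M n L k\<bar>" if "(M, n, L, k) \<in> update_sizes" for M n L k
    using order_trans[OF assms[OF that] abs_ge_self] by (simp add: abs_mult)
  then show "\<forall>\<^sub>F s in principal update_sizes.
      norm (real (g s)) \<le> \<bar>c\<bar> * norm (case s of (M, n, L, k) \<Rightarrow> b M n L k)"
    by (auto simp: eventually_principal)
qed

text \<open>Two programs are given because keeping the batch takes \<open>L\<close> further sample
  cells, which the old sample count does not bound. When the stored data are rebuilt, memory is
  therefore measured by the enlarged collection.\<close>

theorem theorem1:
  shows
    "(\<exists>upd cells.
        updates TYPE('w) upd cells
          (\<lambda>p f q M' n' (x' :: nat \<Rightarrow> nat \<Rightarrow> 'a) h.
            h Estimate = Some (Number (mis_estimator p f q M' n' x'))) \<and>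
        (\<lambda>c. real (length (upd c)))
          \<in> O[principal update_sizes](\<lambda>(M, n, L, k). real M * n_avg M n + real M * real L) \<and>
        (\<lambda>c. real (cells c))
          \<in> O[principal update_sizes](\<lambda>(M, n, L, k). real M * n_avg M n)) \<and>
     (\<exists>upd cells.
        updates TYPE('w) upd cells
          (\<lambda>p f q M' n' (x' :: nat \<Rightarrow> nat \<Rightarrow> 'a) h. h = stored p f q M' n' x') \<and>
        (\<lambda>c. real (length (upd c)))
          \<in> O[principal update_sizes](\<lambda>(M, n, L, k). real M * n_avg M n + real M * real L) \<and>
        (\<lambda>c. real (cells c))
          \<in> O[principal update_sizes](\<lambda>(M, n, L, k).
              real (new_M M k) * n_avg (new_M M k) (new_n M n L k)))"
proof (intro conjI)
  let ?upd = "\<lambda>(M, n, L, k). update_estimate M n L k"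
  let ?C = "\<lambda>(M, n, L, k). estimate_cells M n k"
  show "\<exists>upd cells.
      updates TYPE('w) upd cells
        (\<lambda>p f q M' n' (x' :: nat \<Rightarrow> nat \<Rightarrow> 'a) h.
          h Estimate = Some (Number (mis_estimator p f q M' n' x'))) \<and>
      (\<lambda>c. real (length (upd c)))
        \<in> O[principal update_sizes](\<lambda>(M, n, L, k). real M * n_avg M n + real M * real L) \<and>
      (\<lambda>c. real (cells c))
        \<in> O[principal update_sizes](\<lambda>(M, n, L, k). real M * n_avg M n)"
  proof (intro exI conjI)
    show "updates TYPE('w) ?upd (\<lambda>s. card (?C s))
        (\<lambda>p f q M' n' (x' :: nat \<Rightarrow> nat \<Rightarrow> 'a) h.
          h Estimate = Some (Number (mis_estimator p f q M' n' x')))"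
      by (rule updatesI)
        (use targets_update_estimate in
          \<open>auto simp: batch_update.exec_update_estimate estimate_cells_def split: prod.splits\<close>)
    show "(\<lambda>s. real (length (?upd s)))
        \<in> O[principal update_sizes](\<lambda>(M, n, L, k). real M * n_avg M n + real M * real L)"
    proof (rule bigo_sizesI[where c = 20])
      fix M n L k assume s: "(M, n, L, k) \<in> update_sizes"
      then have "1 \<le> M" by (simp add: update_sizes_def)
      with of_nat_mono[OF length_update_estimate[OF s], where 'a = real]
      show "real (length (?upd (M, n, L, k))) \<le> 20 * (real M * n_avg M n + real M * real L)"
        by (simp add: n_avg_mult)
    qed
    show "(\<lambda>s. real (card (?C s))) \<in> O[principal update_sizes](\<lambda>(M, n, L, k). real M * n_avg M n)"
    proof (rule bigo_sizesI[where c = 10])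
      fix M n L k assume s: "(M, n, L, k) \<in> update_sizes"
      then have "1 \<le> M" by (simp add: update_sizes_def)
      with of_nat_mono[OF card_estimate_cells[OF s], where 'a = real]
      show "real (card (?C (M, n, L, k))) \<le> 10 * (real M * n_avg M n)"
        by (simp add: n_avg_mult)
    qed
  qed
next
  let ?upd = "\<lambda>(M, n, L, k). update_stored M n L k"
  let ?C = "\<lambda>(M, n, L, k). stored_cells M n L k"
  show "\<exists>upd cells.
      updates TYPE('w) upd cells
        (\<lambda>p f q M' n' (x' :: nat \<Rightarrow> nat \<Rightarrow> 'a) h. h = stored p f q M' n' x') \<and>
      (\<lambda>c. real (length (upd c)))
        \<in> O[principal update_sizes](\<lambda>(M, n, L, k). real M * n_avg M n + real M * real L) \<and>
      (\<lambda>c. real (cells c))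
        \<in> O[principal update_sizes](\<lambda>(M, n, L, k).
            real (new_M M k) * n_avg (new_M M k) (new_n M n L k))"
  proof (intro exI conjI)
    show "updates TYPE('w) ?upd (\<lambda>s. card (?C s))
        (\<lambda>p f q M' n' (x' :: nat \<Rightarrow> nat \<Rightarrow> 'a) h. h = stored p f q M' n' x')"
    proof (rule updatesI)
      show "target ` set (?upd (M, n, L, k)) \<subseteq> ?C (M, n, L, k)" if "k \<le> M" for M n L k
        using targets_update_stored[OF that] by simp
      show "footprint M n \<subseteq> ?C (M, n, L, k)" for M n L k
        using footprint_enlarged[of M n k L] by (auto simp: stored_cells_def)
    qed (auto simp: batch_update.exec_update_stored stored_cells_def split: prod.splits)
    show "(\<lambda>s. real (length (?upd s)))
        \<in> O[principal update_sizes](\<lambda>(M, n, L, k). real M * n_avg M n + real M * real L)"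
    proof (rule bigo_sizesI[where c = 20])
      fix M n L k assume s: "(M, n, L, k) \<in> update_sizes"
      then have "1 \<le> M" by (simp add: update_sizes_def)
      with of_nat_mono[OF length_update_stored[OF s], where 'a = real]
      show "real (length (?upd (M, n, L, k))) \<le> 20 * (real M * n_avg M n + real M * real L)"
        by (simp add: n_avg_mult)
    qed
    show "(\<lambda>s. real (card (?C s))) \<in> O[principal update_sizes](\<lambda>(M, n, L, k).
        real (new_M M k) * n_avg (new_M M k) (new_n M n L k))"
    proof (rule bigo_sizesI[where c = 10])
      fix M n L k assume s: "(M, n, L, k) \<in> update_sizes"
      then have "1 \<le> new_M M k" by (simp add: update_sizes_def new_M_def)
      with of_nat_mono[OF card_stored_cells[OF s], where 'a = real]
      show "real (card (?C (M, n, L, k))) \<le>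
          10 * (real (new_M M k) * n_avg (new_M M k) (new_n M n L k))"
        by (simp add: n_avg_mult)
    qed
  qed
qed

end
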